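(* Let $A:\langle k,X\rangle\rightarrow\langle l,Y\rangle$, $B:\langle l,Y\rangle\rightarrow\langle m,Z\rangle$ and $C:\langle m,Z\rangle\rightarrow\langle n,W\rangle$ be (concrete) fuzzy bigraphs whose supports $|A|$, $|B|$, $|C|$ are pairwise disjoint, so that all the composites below are defined. Then \[ C\circ(B\circ A)=(C\circ B)\circ A . \]
   Context: Throughout, $L$ is a frame: a partially ordered set in which every subset has a join $\bigvee$, every finite subset has a meet $\wedge$, and $x\wedge\bigvee Y=\bigvee\{x\wedge y\mid y\in Y\}$; $\top,\bot$ denote its top and bottom. An $L$-fuzzy relation between sets $S,T$ is a map $R:S\times T\rightarrow L$; the composite of $R:S\times T\to L$ and $Q:T\times U\to L$ is $(Q\circ R)(s,u)=\bigvee_{t\in T}R(s,t)\wedge Q(t,u)$. $S\uplus T$ denotes the union of disjoint sets; for fuzzy relations on disjoint domains, $R\uplus R'$ is the fuzzy relation agreeing with $R$ on the domain of $R$ and with $R'$ on the domain of $R'$. A natural number $m$ is identified with the set $\{0,\dots,m-1\}$. Fix an infinite set $\mathcal{V}$ of node identifiers, an infinite set $\mathcal{E}$ of edge identifiers, an infinite set $\mathcal{X}$ of names, and a set $\mathcal{K}$ of controls with an arity map $\mathrm{ar}:\mathcal{K}\to\mathbb{N}$. A fuzzy place graph $F=(V_F,\mathrm{ctrl}_F,\mathrm{prnt}_F):k\rightarrow m$ consists of a finite $V_F\subset\mathcal{V}$ and $L$-fuzzy relations $\mathrm{ctrl}_F:V_F\times\mathcal{K}\to L$ and $\mathrm{prnt}_F:(k\uplus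 V_F)\times(V_F\uplus m)\to L$. A fuzzy link graph $F=(V_F,E_F,\mathrm{ctrl}_F,\mathrm{link}_F):X\rightarrow Y$ (with $X,Y$ finite subsets of $\mathcal{X}$) consists of finite $V_F\subset\mathcal{V}$, $E_F\subset\mathcal{E}$, a fuzzy relation $\mathrm{ctrl}_F:V_F\times\mathcal{K}\to L$, a finite set $P_F$ of ports (pairs $(v,i)$ with $v\in V_F$), and an $L$-fuzzy relation $\mathrm{link}_F:(X\uplus P_F)\times(E_F\uplus Y)\to L$. A fuzzy bigraph $F=(V_F,E_F,\mathrm{ctrl}_F,\mathrm{prnt}_F,\mathrm{link}_F):\langle k,X\rangle\rightarrow\langle m,Y\rangle$ consists of a fuzzy place graph $F^{\mathsf P}=(V_F,\mathrm{ctrl}_F,\mathrm{prnt}_F):k\to m$ and a fuzzy link graph $F^{\mathsf L}=(V_F,E_F,\mathrm{ctrl}_F,\mathrm{link}_F):X\to Y$; its support is $|F|=V_F\uplus E_F$. Composition of place graphs: for $F:k\to m$, $G:m\to n$ with $V_F\cap V_G=\emptyset$, $G\circ F=(V,\mathrm{ctrl},\mathrm{prnt}):k\to n$ with $V=V_F\uplus V_G$, $\mathrm{ctrl}=\mathrm{ctrl}_F\uplus\mathrm{ctrl}_G$, and $\mathrm{prnt}(w,w')=\mathrm{prnt}_F(w,w')$ if $w\in k\uplus V_F$, $w'\in V_F$; $=\bigvee_{j\in m}\mathrm{prnt}_F(w,j)\wedge\mathrm{prnt}_G(j,w')$ if $w\in k\uplus V_F$, $w'\in V_G\uplus n$; $=\mathrm{prnt}_G(w,w')$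 if $w\in V_G$, $w'\in V_G\uplus n$; $=\bot$ otherwise. Composition of link graphs: for $F:X\to Y$, $G:Y\to Z$ with disjoint supports, $G\circ F=(V_F\uplus V_G,E_F\uplus E_G,\mathrm{ctrl}_F\uplus\mathrm{ctrl}_G,\mathrm{link}):X\to Z$ with ports $P_F\uplus P_G$ and $\mathrm{link}(q,q')=\mathrm{link}_F(q,q')$ if $q\in X\uplus P_F$, $q'\in E_F$; $=\bigvee_{y\in Y}\mathrm{link}_F(q,y)\wedge\mathrm{link}_G(y,q')$ if $q\in X\uplus P_F$, $q'\in E_G\uplus Z$; $=\mathrm{link}_G(q,q')$ if $q\in P_G$, $q'\in E_G\uplus Z$; $=\bot$ otherwise. Composition of fuzzy bigraphs $F:I\to J$, $G:J\to K$ with $|F|\cap|G|=\emptyset$ is componentwise: $G\circ F=(G^{\mathsf P}\circ F^{\mathsf P},\,G^{\mathsf L}\circ F^{\mathsf L}):I\to K$. *)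

theory Defs
  imports Complex_Main "HOL-Library.FuncSet" "HOL-Library.Infinite_Typeclass"
begin

(* The library class complete_distrib_lattice demands full complete distributivity,
   which is strictly stronger than the frame law. *)
class frame = complete_lattice +
  assumes inf_Sup_frame: "inf x (Sup Y) = Sup ((\<lambda>y. inf x y) ` Y)"

(* A fuzzy relation S x T -> L is a function that is undefined off S x T, so that
   HOL equality of such functions is equality of maps with domain S x T. *)
definition fuzzy_rel :: "'s set \<Rightarrow> 't set \<Rightarrow> ('s \<times> 't \<Rightarrow> 'l::frame) set" where
  "fuzzy_rel S T = S \<times> T \<rightarrow>\<^sub>E UNIV"

(* A set of controls and its arity map. The three infinite sets of identifiers and names
   are the types 'v (nodes), 'e (edges) and 'x (names), constrained to class infinite
   where the signature is attached to a graph. *)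
record 'c signature =
  controls :: "'c set"
  arity :: "'c \<Rightarrow> nat"

(* Graphs carry their interfaces, so equality of graphs includes equality of source and
   target. The number m stands for {..<m}. Unions written as disjoint in the mathematics
   are sums whenever their parts come from different universes. *)
record ('v, 'c, 'l) place_graph =
  p_inner :: nat
  p_outer :: nat
  p_nodes :: "'v set"
  p_ctrl :: "'v \<times> 'c \<Rightarrow> 'l"
  p_prnt :: "(nat + 'v) \<times> ('v + nat) \<Rightarrow> 'l"

record ('v, 'e, 'x, 'c, 'l) link_graph =
  l_inner :: "'x set"
  l_outer :: "'x set"
  l_nodes :: "'v set"
  l_edges :: "'e set"
  l_ctrl :: "'v \<times> 'c \<Rightarrow> 'l"
  l_ports :: "('v \<times> nat) set"
  l_link :: "('x + 'v \<times> nat) \<times> ('e + 'x) \<Rightarrow> 'l"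

record ('v, 'e, 'x, 'c, 'l) bigraph =
  b_inner :: "nat \<times> 'x set"
  b_outer :: "nat \<times> 'x set"
  b_nodes :: "'v set"
  b_edges :: "'e set"
  b_ctrl :: "'v \<times> 'c \<Rightarrow> 'l"
  b_prnt :: "(nat + 'v) \<times> ('v + nat) \<Rightarrow> 'l"
  b_ports :: "('v \<times> nat) set"
  b_link :: "('x + 'v \<times> nat) \<times> ('e + 'x) \<Rightarrow> 'l"

definition fuzzy_place_graph ::
    "'c signature \<Rightarrow> ('v::infinite, 'c, 'l::frame) place_graph \<Rightarrow> nat \<Rightarrow> nat \<Rightarrow> bool" where
  "fuzzy_place_graph \<Sigma> F k m \<longleftrightarrow>
     p_inner F = k \<and> p_outer F = m \<and> finite (p_nodes F) \<and>
     p_ctrl F \<in> fuzzy_rel (p_nodes F) (controls \<Sigma>) \<and>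
     p_prnt F \<in> fuzzy_rel ({..<k} <+> p_nodes F) (p_nodes F <+> {..<m})"

(* The finite set of ports is part of the data; it is not determined by the arities of
   the (fuzzy) controls. *)
definition fuzzy_link_graph ::
    "'c signature \<Rightarrow> ('v::infinite, 'e::infinite, 'x::infinite, 'c, 'l::frame) link_graph \<Rightarrow>
     'x set \<Rightarrow> 'x set \<Rightarrow> bool" where
  "fuzzy_link_graph \<Sigma> F X Y \<longleftrightarrow>
     l_inner F = X \<and> l_outer F = Y \<and> finite X \<and> finite Y \<and>
     finite (l_nodes F) \<and> finite (l_edges F) \<and>
     l_ctrl F \<in> fuzzy_rel (l_nodes F) (controls \<Sigma>) \<and>
     finite (l_ports F) \<and> l_ports F \<subseteq> l_nodes F \<times> UNIV \<and>
     l_link F \<in> fuzzy_rel (X <+> l_ports F) (l_edges F <+> Y)"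

definition place_of :: "('v, 'e, 'x, 'c, 'l) bigraph \<Rightarrow> ('v, 'c, 'l) place_graph" where
  "place_of F =
     \<lparr>p_inner = fst (b_inner F), p_outer = fst (b_outer F), p_nodes = b_nodes F,
      p_ctrl = b_ctrl F, p_prnt = b_prnt F\<rparr>"

definition link_of :: "('v, 'e, 'x, 'c, 'l) bigraph \<Rightarrow> ('v, 'e, 'x, 'c, 'l) link_graph" where
  "link_of F =
     \<lparr>l_inner = snd (b_inner F), l_outer = snd (b_outer F), l_nodes = b_nodes F,
      l_edges = b_edges F, l_ctrl = b_ctrl F, l_ports = b_ports F, l_link = b_link F\<rparr>"

(* Meaningful only if both arguments have the same nodes and the same control relation. *)
definition mk_bigraph ::
    "('v, 'c, 'l) place_graph \<Rightarrow> ('v, 'e, 'x, 'c, 'l) link_graph \<Rightarrow> ('v, 'e, 'x, 'c, 'l) bigraph" where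
  "mk_bigraph P L =
     \<lparr>b_inner = (p_inner P, l_inner L), b_outer = (p_outer P, l_outer L),
      b_nodes = p_nodes P, b_edges = l_edges L, b_ctrl = p_ctrl P, b_prnt = p_prnt P,
      b_ports = l_ports L, b_link = l_link L\<rparr>"

definition fuzzy_bigraph ::
    "'c signature \<Rightarrow> ('v::infinite, 'e::infinite, 'x::infinite, 'c, 'l::frame) bigraph \<Rightarrow>
     nat \<times> 'x set \<Rightarrow> nat \<times> 'x set \<Rightarrow> bool" where
  "fuzzy_bigraph \<Sigma> F I J \<longleftrightarrow>
     b_inner F = I \<and> b_outer F = J \<and>
     fuzzy_place_graph \<Sigma> (place_of F) (fst I) (fst J) \<and>
     fuzzy_link_graph \<Sigma> (link_of F) (snd I) (snd J)"

definition support :: "('v, 'e, 'x, 'c, 'l) bigraph \<Rightarrow> ('v + 'e) set" where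
  "support F = b_nodes F <+> b_edges F"

(* ctrl_F and ctrl_G have disjoint domains V_F x K and V_G x K and are undefined outside
   them, so their disjoint union may be selected by the node alone. *)
definition ctrl_union :: "'v set \<Rightarrow> ('v \<times> 'c \<Rightarrow> 'l) \<Rightarrow> ('v \<times> 'c \<Rightarrow> 'l) \<Rightarrow> 'v \<times> 'c \<Rightarrow> 'l" where
  "ctrl_union V R R' = (\<lambda>(v, c). if v \<in> V then R (v, c) else R' (v, c))"

(* The composites below are total functions, but they are intended only when the outer
   interface of F is the inner interface of G and the supports are disjoint. *)
definition place_comp ::
    "('v, 'c, 'l::frame) place_graph \<Rightarrow> ('v, 'c, 'l) place_graph \<Rightarrow> ('v, 'c, 'l) place_graph"
    (infixr "\<circ>\<^sub>P" 55) where
  "G \<circ>\<^sub>P F =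
     (let k = p_inner F; m = p_outer F; n = p_outer G;
          VF = p_nodes F; VG = p_nodes G; V = VF \<union> VG
      in \<lparr>p_inner = k, p_outer = n, p_nodes = V,
          p_ctrl = ctrl_union VF (p_ctrl F) (p_ctrl G),
          p_prnt = (\<lambda>(w, w') \<in> ({..<k} <+> V) \<times> (V <+> {..<n}).
            if w \<in> {..<k} <+> VF \<and> w' \<in> Inl ` VF then p_prnt F (w, w')
            else if w \<in> {..<k} <+> VF \<and> w' \<in> VG <+> {..<n} then
              (SUP j\<in>{..<m}. inf (p_prnt F (w, Inr j)) (p_prnt G (Inl j, w')))
            else if w \<in> Inr ` VG \<and> w' \<in> VG <+> {..<n} then p_prnt G (w, w')
            else bot)\<rparr>)"

definition link_comp ::
    "('v, 'e, 'x, 'c, 'l::frame) link_graph \<Rightarrow> ('v, 'e, 'x, 'c, 'l) link_graph \<Rightarrow>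
     ('v, 'e, 'x, 'c, 'l) link_graph"
    (infixr "\<circ>\<^sub>L" 55) where
  "G \<circ>\<^sub>L F =
     (let X = l_inner F; Y = l_outer F; Z = l_outer G;
          EF = l_edges F; EG = l_edges G; PF = l_ports F; PG = l_ports G
      in \<lparr>l_inner = X, l_outer = Z, l_nodes = l_nodes F \<union> l_nodes G, l_edges = EF \<union> EG,
          l_ctrl = ctrl_union (l_nodes F) (l_ctrl F) (l_ctrl G),
          l_ports = PF \<union> PG,
          l_link = (\<lambda>(q, q') \<in> (X <+> (PF \<union> PG)) \<times> ((EF \<union> EG) <+> Z).
            if q \<in> X <+> PF \<and> q' \<in> Inl ` EF then l_link F (q, q')
            else if q \<in> X <+> PF \<and> q' \<in> EG <+> Z then
              (SUP y\<in>Y. inf (l_link F (q, Inr y)) (l_link G (Inl y, q')))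
            else if q \<in> Inr ` PG \<and> q' \<in> EG <+> Z then l_link G (q, q')
            else bot)\<rparr>)"

definition bigraph_comp ::
    "('v, 'e, 'x, 'c, 'l::frame) bigraph \<Rightarrow> ('v, 'e, 'x, 'c, 'l) bigraph \<Rightarrow>
     ('v, 'e, 'x, 'c, 'l) bigraph"
    (infixr "\<circ>\<^sub>B" 55) where
  "G \<circ>\<^sub>B F = mk_bigraph (place_of G \<circ>\<^sub>P place_of F) (link_of G \<circ>\<^sub>L link_of F)"

lemma place_of_comp: "place_of (G \<circ>\<^sub>B F) = place_of G \<circ>\<^sub>P place_of F"
  by (simp add: place_of_def bigraph_comp_def mk_bigraph_def place_comp_def Let_def)

lemma link_of_comp: "link_of (G \<circ>\<^sub>B F) = link_of G \<circ>\<^sub>L link_of F"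
  by (simp add: link_of_def place_of_def bigraph_comp_def mk_bigraph_def place_comp_def
      link_comp_def Let_def)

lemma support_comp: "support (G \<circ>\<^sub>B F) = support F \<union> support G"
  by (auto simp: support_def bigraph_comp_def mk_bigraph_def place_comp_def
      link_comp_def link_of_def place_of_def Let_def)

lemma fuzzy_bigraph_comp:
  assumes "fuzzy_bigraph \<Sigma> F I J" "fuzzy_bigraph \<Sigma> G J K"
  shows "fuzzy_bigraph \<Sigma> (G \<circ>\<^sub>B F) I K"
proof -
  have c: "ctrl_union VF R R' \<in> fuzzy_rel (VF \<union> VG) S"
    if "R \<in> fuzzy_rel VF S" "R' \<in> fuzzy_rel VG S" for VF VG S and R R' :: "'b \<times> 'a \<Rightarrow> 'e"
    using that by (auto simp: ctrl_union_def fuzzy_rel_def PiE_iff extensional_def)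
  have i: "b_inner (G \<circ>\<^sub>B F) = I" "b_outer (G \<circ>\<^sub>B F) = K"
    using assms by (auto simp: fuzzy_bigraph_def bigraph_comp_def mk_bigraph_def
        place_comp_def link_comp_def place_of_def link_of_def Let_def)
  have "fuzzy_place_graph \<Sigma> (place_of G \<circ>\<^sub>P place_of F) (fst I) (fst K)"
    using assms c by (auto simp: fuzzy_bigraph_def fuzzy_place_graph_def place_comp_def
        Let_def fuzzy_rel_def)
  moreover have "fuzzy_link_graph \<Sigma> (link_of G \<circ>\<^sub>L link_of F) (snd I) (snd K)"
    using assms c by (auto simp: fuzzy_bigraph_def fuzzy_link_graph_def link_comp_def
        Let_def fuzzy_rel_def)
  ultimately show ?thesis
    using i by (simp add: fuzzy_bigraph_def place_of_comp link_of_comp)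
qed

end

(* Both parts of a composite bigraph are composites of fuzzy relations in which only the middle
   interface is joined over. Disjointness of the supports separates the cases of the definition,
   and the one case crossing both interfaces is associativity of relational composition, which
   is the frame law together with the commutation of joins. *)

theory Submission
  imports Defs
begin

lemma inf_SUP_frame:
  fixes x :: "'l::frame"
  shows "inf x (SUP i\<in>I. f i) = (SUP i\<in>I. inf x (f i))"
  by (simp add: inf_Sup_frame image_image)

lemma SUP_inf_frame:
  fixes x :: "'l::frame"
  shows "inf (SUP i\<in>I. f i) x = (SUP i\<in>I. inf (f i) x)"
  by (simp add: inf_SUP_frame inf.commute[of _ x])

text \<open>Both sides equal the join of \<open>inf (f y) (inf (g y z) (h z))\<close> over all
  pairs, since each outer meet can be pulled into the inner join.\<close>

lemma SUP_inf_assoc: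
  fixes f :: "'y \<Rightarrow> 'l::frame" and g :: "'y \<Rightarrow> 'z \<Rightarrow> 'l" and h :: "'z \<Rightarrow> 'l"
  shows "(SUP z\<in>Z. inf (SUP y\<in>Y. inf (f y) (g y z)) (h z)) =
    (SUP y\<in>Y. inf (f y) (SUP z\<in>Z. inf (g y z) (h z)))"
  \<comment> \<open>Fixing one index set in \<open>SUP_commute\<close> makes the exchange of joins
    one-way.\<close>
  by (simp add: SUP_inf_frame inf_SUP_frame inf.assoc SUP_commute[of _ Z])

text \<open>The common shape of \<open>p_prnt\<close> and \<open>l_link\<close> of a composite. A place graph is the instance
  whose points \<open>P\<close> and targets \<open>E\<close> both are the nodes.\<close>

definition wiring_comp ::
    "'i set \<Rightarrow> 'i set \<Rightarrow> 'i set \<Rightarrow> 'p set \<Rightarrow> 'e set \<Rightarrow> 'p set \<Rightarrow> 'e set \<Rightarrow>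
     (('i + 'p) \<times> ('e + 'i) \<Rightarrow> 'l::frame) \<Rightarrow> (('i + 'p) \<times> ('e + 'i) \<Rightarrow> 'l) \<Rightarrow>
     ('i + 'p) \<times> ('e + 'i) \<Rightarrow> 'l" where
  "wiring_comp X Y Z PF EF PG EG f g =
     (\<lambda>(q, q') \<in> (X <+> (PF \<union> PG)) \<times> ((EF \<union> EG) <+> Z).
        if q \<in> X <+> PF \<and> q' \<in> Inl ` EF then f (q, q')
        else if q \<in> X <+> PF \<and> q' \<in> EG <+> Z then
          (SUP y\<in>Y. inf (f (q, Inr y)) (g (Inl y, q')))
        else if q \<in> Inr ` PG \<and> q' \<in> EG <+> Z then g (q, q')
        else bot)"

lemma Inl_Inr_mem:
  "Inl a \<in> A <+> B \<longleftrightarrow> a \<in> A" "Inr b \<in> A <+> B \<longleftrightarrow> b \<in> B"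
  "Inl a \<in> Inl ` A \<longleftrightarrow> a \<in> A" "Inr b \<notin> Inl ` A"
  "Inr b \<in> Inr ` B \<longleftrightarrow> b \<in> B" "Inl a \<notin> Inr ` B"
  by auto

text \<open>A source in \<open>X <+> PA\<close> reaches \<open>EA\<close> by \<open>a\<close> alone,
  \<open>EB\<close> through \<open>Y\<close>, and \<open>EC <+> W\<close> through \<open>Y\<close>
  and \<open>Z\<close>; only this last case needs \<open>SUP_inf_assoc\<close>. Sources in
  \<open>PB\<close> start with \<open>b\<close>, those in \<open>PC\<close> with \<open>c\<close>,
  and backward entries are \<open>bot\<close> on both sides. Disjointness leaves one case per
  entry.\<close>

lemma wiring_comp_assoc:
  fixes a b c :: "('i + 'p) \<times> ('e + 'i) \<Rightarrow> 'l::frame"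
  assumes P: "PA \<inter> PB = {}" "PA \<inter> PC = {}" "PB \<inter> PC = {}"
    and E: "EA \<inter> EB = {}" "EA \<inter> EC = {}" "EB \<inter> EC = {}"
  shows "wiring_comp X Z W (PA \<union> PB) (EA \<union> EB) PC EC (wiring_comp X Y Z PA EA PB EB a b) c =
    wiring_comp X Y W PA EA (PB \<union> PC) (EB \<union> EC) a (wiring_comp Y Z W PB EB PC EC b c)"
    (is "?L = ?R")
proof
  fix p :: "('i + 'p) \<times> ('e + 'i)"
  obtain q q' where "p = (q, q')" by (cases p)
  then show "?L p = ?R p"
    using P E
    by (cases q; cases q')
      (auto simp: wiring_comp_def Inl_Inr_mem disjoint_iff SUP_inf_assoc)
qed

lemma ctrl_union_assoc:
  "ctrl_union (U \<union> V) (ctrl_union U R S) T = ctrl_union U R (ctrl_union V S T)"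
  by (auto simp: ctrl_union_def)

text \<open>Unfolding by this equation keeps \<open>wiring_comp\<close> folded, so that
  \<open>wiring_comp_assoc\<close> can rewrite the nested relations.\<close>

lemma place_comp_eq:
  "G \<circ>\<^sub>P F =
     \<lparr>p_inner = p_inner F, p_outer = p_outer G, p_nodes = p_nodes F \<union> p_nodes G,
      p_ctrl = ctrl_union (p_nodes F) (p_ctrl F) (p_ctrl G),
      p_prnt = wiring_comp {..<p_inner F} {..<p_outer F} {..<p_outer G}
        (p_nodes F) (p_nodes F) (p_nodes G) (p_nodes G) (p_prnt F) (p_prnt G)\<rparr>"
  by (simp add: place_comp_def wiring_comp_def Let_def)

lemma link_comp_eq:
  "G \<circ>\<^sub>L F =
     \<lparr>l_inner = l_inner F, l_outer = l_outer G, l_nodes = l_nodes F \<union> l_nodes G,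
      l_edges = l_edges F \<union> l_edges G,
      l_ctrl = ctrl_union (l_nodes F) (l_ctrl F) (l_ctrl G), l_ports = l_ports F \<union> l_ports G,
      l_link = wiring_comp (l_inner F) (l_outer F) (l_outer G)
        (l_ports F) (l_edges F) (l_ports G) (l_edges G) (l_link F) (l_link G)\<rparr>"
  by (simp add: link_comp_def wiring_comp_def Let_def)

text \<open>The interface equation identifies the set joined over in
  \<open>G \<circ>\<^sub>P F\<close> with the source of \<open>H \<circ>\<^sub>P G\<close>: it is
  the \<open>Y\<close> of \<open>wiring_comp_assoc\<close>. Both sides read \<open>Z\<close> off
  \<open>p_outer G\<close>.\<close>

lemma place_comp_assoc:
  assumes "p_outer F = p_inner G"
    and "p_nodes F \<inter> p_nodes G = {}" "p_nodes F \<inter> p_nodes H = {}" "p_nodes G \<inter> p_nodes H = {}"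
  shows "H \<circ>\<^sub>P (G \<circ>\<^sub>P F) = (H \<circ>\<^sub>P G) \<circ>\<^sub>P F"
  using assms by (simp add: place_comp_eq ctrl_union_assoc wiring_comp_assoc Un_assoc)

lemma link_comp_assoc:
  assumes "l_outer F = l_inner G"
    and "l_ports F \<inter> l_ports G = {}" "l_ports F \<inter> l_ports H = {}" "l_ports G \<inter> l_ports H = {}"
    and "l_edges F \<inter> l_edges G = {}" "l_edges F \<inter> l_edges H = {}" "l_edges G \<inter> l_edges H = {}"
  shows "H \<circ>\<^sub>L (G \<circ>\<^sub>L F) = (H \<circ>\<^sub>L G) \<circ>\<^sub>L F"
  using assms by (simp add: link_comp_eq ctrl_union_assoc wiring_comp_assoc Un_assoc)

theorem mainTheorem1:
  fixes \<Sigma> :: "'c signature"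
    and A B C :: "('v::infinite, 'e::infinite, 'x::infinite, 'c, 'l::frame) bigraph"
    and k l m n :: nat
    and X Y Z W :: "'x set"
  assumes "fuzzy_bigraph \<Sigma> A (k, X) (l, Y)"
    and "fuzzy_bigraph \<Sigma> B (l, Y) (m, Z)"
    and "fuzzy_bigraph \<Sigma> C (m, Z) (n, W)"
    and "support A \<inter> support B = {}"
    and "support A \<inter> support C = {}"
    and "support B \<inter> support C = {}"
  shows "C \<circ>\<^sub>B (B \<circ>\<^sub>B A) = (C \<circ>\<^sub>B B) \<circ>\<^sub>B A"
proof -
  \<comment> \<open>The support does not contain the ports; they are disjoint because each one
    carries its node.\<close>
  have ports: "b_ports A \<subseteq> b_nodes A \<times> UNIV" "b_ports B \<subseteq> b_nodes B \<times> UNIV"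
      "b_ports C \<subseteq> b_nodes C \<times> UNIV"
    using assms(1-3) by (simp_all add: fuzzy_bigraph_def fuzzy_link_graph_def link_of_def)
  have interface: "b_outer A = b_inner B"
    using assms(1,2) by (simp add: fuzzy_bigraph_def)
  have nodes: "b_nodes A \<inter> b_nodes B = {}" "b_nodes A \<inter> b_nodes C = {}"
      "b_nodes B \<inter> b_nodes C = {}"
    and edges: "b_edges A \<inter> b_edges B = {}" "b_edges A \<inter> b_edges C = {}"
      "b_edges B \<inter> b_edges C = {}"
    using assms(4-6) by (auto simp: support_def)
  have "place_of C \<circ>\<^sub>P (place_of B \<circ>\<^sub>P place_of A) = (place_of C \<circ>\<^sub>P place_of B) \<circ>\<^sub>P place_of A"
    by (rule place_comp_assoc) (use interface nodes in \<open>simp_all add: place_of_def\<close>)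
  moreover have "link_of C \<circ>\<^sub>L (link_of B \<circ>\<^sub>L link_of A) = (link_of C \<circ>\<^sub>L link_of B) \<circ>\<^sub>L link_of A"
  proof (rule link_comp_assoc)
    show "l_ports (link_of A) \<inter> l_ports (link_of B) = {}"
      "l_ports (link_of A) \<inter> l_ports (link_of C) = {}"
      "l_ports (link_of B) \<inter> l_ports (link_of C) = {}"
      using ports nodes by (auto simp: link_of_def)
  qed (use interface edges in \<open>simp_all add: link_of_def\<close>)
  ultimately show ?thesis
    \<comment> \<open>Only the outermost composites are unfolded; the inner ones stay folded for
      \<open>place_of_comp\<close> and \<open>link_of_comp\<close>.\<close>
    by (simp add: bigraph_comp_def[of C "B \<circ>\<^sub>B A"] bigraph_comp_def[of "C \<circ>\<^sub>B B" A]
        place_of_comp link_of_comp)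
qed

end
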